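(* Let $b\geq 2$ and $n\geq b+1$ be integers. Then $\sigma_{k,\max}(b,n)=1$ for all integers $k$ with $3\leq k\leq b$.
   Context: Graphs are finite and simple. For a graph $G=(V,E)$ with boundary $B\subseteq V$, the Steklov operator $\Lambda:\mathbb{R}^B\to\mathbb{R}^B$ is $\Lambda(f)=\frac{\partial \hat f}{\partial n}$, where $\hat f:V\to\mathbb{R}$ is the harmonic extension of $f$ (that is, $\hat f|_B=f$ and $\sum_{y\sim x}(\hat f(x)-\hat f(y))=0$ for every $x\in V\setminus B$) and $\frac{\partial \hat f}{\partial n}(x)=\sum_{y\sim x}(\hat f(x)-\hat f(y))$ for $x\in B$. Its eigenvalues, counted with multiplicity, are $0=\sigma_1\le\sigma_2\le\cdots\le\sigma_{|B|}$. For a tree $T$ the boundary is the set of leaves (vertices of degree $1$), and $\sigma_k(T)$ is the $k$-th Steklov eigenvalue with this boundary. $\mathcal{T}(b,n)$ is the set of trees with exactly $b$ leaves and $n$ vertices, and $\sigma_{k,\max}(b,n)=\max_{T\in\mathcal{T}(b,n)}\sigma_k(T)$. *)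

theory Defs
  imports
    "HOL-Library.FuncSet"
    "HOL-Library.Multiset"
    "Graph_Theory.Pair_Digraph"
    "Graph_Theory.Digraph_Component"
    "Jordan_Normal_Form.Char_Poly"
begin

text \<open>
  A finite simple graph is a \<^locale>\<open>pair_graph\<close>: a finite, loop-free, symmetric digraph
  without parallel arcs, each edge being represented by its two opposite arcs.
\<close>

definition neighbours :: "'a pair_pre_digraph \<Rightarrow> 'a \<Rightarrow> 'a set" where
  "neighbours G x = {y. (x, y) \<in> parcs G}"

text \<open>
  This expression serves both as the harmonicity condition, at interior vertices, and as the
  outward normal derivative, at boundary vertices.
\<close>

definition laplacian :: "'a pair_pre_digraph \<Rightarrow> ('a \<Rightarrow> real) \<Rightarrow> 'a \<Rightarrow> real" where
  "laplacian G h x = (\<Sum>y\<in>neighbours G x. h x - h y)"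

text \<open>
  Real functions on a set are represented by \<^const>\<open>extensional\<close> functions, so that the harmonic
  extension is unique as a HOL function if \<open>G\<close> is a finite connected graph and \<open>B\<close> is nonempty.
\<close>

definition harmonic_extension ::
    "'a pair_pre_digraph \<Rightarrow> 'a set \<Rightarrow> ('a \<Rightarrow> real) \<Rightarrow> 'a \<Rightarrow> real" where
  "harmonic_extension G B f = (THE h. h \<in> extensional (pverts G) \<and>
     (\<forall>x\<in>B. h x = f x) \<and> (\<forall>x\<in>pverts G - B. laplacian G h x = 0))"

definition steklov_operator ::
    "'a pair_pre_digraph \<Rightarrow> 'a set \<Rightarrow> ('a \<Rightarrow> real) \<Rightarrow> 'a \<Rightarrow> real" where
  "steklov_operator G B f = (\<lambda>x\<in>B. laplacian G (harmonic_extension G B f) x)"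

text \<open>
  The matrix of the Steklov operator with respect to the basis of indicator functions of the
  boundary vertices. The linear order on the vertices only serves to enumerate this basis.
\<close>

definition steklov_matrix :: "'a::linorder pair_pre_digraph \<Rightarrow> 'a set \<Rightarrow> real mat" where
  "steklov_matrix G B = (let bs = sorted_list_of_set B in
     mat (card B) (card B)
       (\<lambda>(i, j). steklov_operator G B (\<lambda>x\<in>B. if x = bs ! j then 1 else 0) (bs ! i)))"

text \<open>
  The eigenvalues in increasing order, repeated according to multiplicity. The operator is
  symmetric, so algebraic and geometric multiplicities agree and all \<open>card B\<close> roots of the
  characteristic polynomial are real. The numbering starts with \<open>k = 1\<close>.
\<close>

definition steklov_eigenvalues :: "'a::linorder pair_pre_digraph \<Rightarrow> 'a set \<Rightarrow> real list" where
  "steklov_eigenvalues G B = sorted_list_of_multiset (proots (char_poly (steklov_matrix G B)))"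

definition steklov_eigenvalue :: "nat \<Rightarrow> 'a::linorder pair_pre_digraph \<Rightarrow> 'a set \<Rightarrow> real" where
  "steklov_eigenvalue k G B = steklov_eigenvalues G B ! (k - 1)"

text \<open>
  The predicate \<^const>\<open>tree\<close> of the library excludes directed cycles of any length, and
  hence the closed walk \<open>u, v, u\<close> along an edge. A cycle of an undirected graph has length at
  least three.
\<close>

definition undirected_tree :: "'a pair_pre_digraph \<Rightarrow> bool" where
  "undirected_tree G \<longleftrightarrow> pair_graph G \<and> connected (with_proj G) \<and>
     \<not> (\<exists>p. pre_digraph.cycle (with_proj G) p \<and> 3 \<le> length p)"

definition leaves :: "'a pair_pre_digraph \<Rightarrow> 'a set" where
  "leaves G = {x \<in> pverts G. card (neighbours G x) = 1}"

text \<open>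
  Vertices are taken to be natural numbers; every finite graph is isomorphic to such a graph.
\<close>

definition trees :: "nat \<Rightarrow> nat \<Rightarrow> nat pair_pre_digraph set" where
  "trees b n = {T. undirected_tree T \<and> card (leaves T) = b \<and> card (pverts T) = n}"

text \<open>
  The maximum is \<^const>\<open>Greatest\<close> rather than \<^const>\<open>Max\<close>, because the set of trees on
  finite subsets of the natural numbers is infinite (it is finite up to isomorphism).
\<close>

definition steklov_max :: "nat \<Rightarrow> nat \<Rightarrow> nat \<Rightarrow> real" where
  "steklov_max k b n =
     (GREATEST s. \<exists>T\<in>trees b n. s = steklov_eigenvalue k T (leaves T))"

end

theory Submission
  imports Defs "HOL-Computational_Algebra.Fundamental_Theorem_Algebra"
begin

text \<open>
  Every Steklov eigenvalue \<open>\<sigma>\<close> of a tree with at least three vertices is at most \<open>1\<close>, and there is a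
  tree on which all but the first two eigenvalues are equal to \<open>1\<close>.

  For the bound (\<open>steklov_eigenvalues_leaves_le_1\<close>), compare two expressions for the Dirichlet energy
  of the harmonic extension \<open>h\<close> of an eigenfunction. Green's identity gives \<open>\<sigma> S\<close>, where \<open>S\<close> is the
  sum of the squares of \<open>h\<close> over the leaves. The edges at the leaves alone contribute \<open>\<sigma>\<^sup>2 S\<close>, because
  \<open>h\<close> changes by \<open>\<sigma> h b\<close> along the edge at the leaf \<open>b\<close>. Hence \<open>\<sigma>\<^sup>2 \<le> \<sigma>\<close>.

  The bound is attained on a broom: \<open>b - 1\<close> leaves pendant at one vertex, from which a path leads to
  the last leaf. A function on the pendant leaves with sum zero, extended by zero, is harmonic and
  equals its own normal derivative. Such functions form a space of dimension \<open>b - 2\<close>, so the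
  eigenvalue \<open>1\<close> has multiplicity at least \<open>b - 2\<close> (\<open>order_1_char_poly_pendant\<close>). As no eigenvalue
  is larger, \<open>1\<close> occupies all positions from the third on (\<open>sorted_nth_eq_upper_bound\<close>).

  The eigenvalues are the roots of the characteristic polynomial of the Steklov matrix. This matrix is
  symmetric by Green's identity, so all roots are real and the list of eigenvalues has length \<open>b\<close>
  (\<open>length_steklov_eigenvalues\<close>). Harmonic extensions are unique by an energy argument, and they exist
  because uniqueness makes a square linear system solvable.
\<close>

section \<open>Characteristic polynomials and linear systems\<close>

text \<open>
  Induction on the degree: a complex root exists by the fundamental theorem of algebra, it is real
  by hypothesis, and splitting off its linear factor leaves a polynomial with no new roots.
\<close>
lemma real_rooted_imp_size_proots:
  fixes p :: "real poly"
  assumes "p \<noteq> 0"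
    and "\<And>z. poly (map_poly complex_of_real p) z = 0 \<Longrightarrow> z \<in> \<real>"
  shows "size (proots p) = degree p"
  using assms
proof (induction "degree p" arbitrary: p)
  case 0
  then show ?case using size_proots_le[of p] by simp
next
  case (Suc n)
  have "degree (map_poly complex_of_real p) = Suc n"
    using Suc.hyps(2) by simp
  then obtain z where z: "poly (map_poly complex_of_real p) z = 0"
    using fundamental_theorem_of_algebra_alt[of "map_poly complex_of_real p"]
    by (metis alg_closed_imp_poly_has_root zero_less_Suc)
  then obtain r where "z = of_real r"
    using Suc.prems(2) by (auto elim: Reals_cases)
  with z have "poly p r = 0" by simp
  then obtain q where p: "p = [:-r, 1:] * q"
    by (auto simp: poly_eq_0_iff_dvd)
  have q0: "q \<noteq> 0" using p Suc.prems(1) by auto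
  have deg: "degree p = Suc (degree q)"
    unfolding p using q0 by (subst degree_mult_eq) auto
  have "size (proots q) = degree q"
  proof (rule Suc.hyps(1))
    show "n = degree q" using deg Suc.hyps(2) by simp
    show "q \<noteq> 0" by fact
    interpret map_poly_comm_ring_hom complex_of_real ..
    show "z \<in> \<real>" if "poly (map_poly complex_of_real q) z = 0" for z
      using that by (intro Suc.prems(2)) (simp only: p hom_mult poly_mult mult_zero_right)
  qed
  then show ?case
    using q0 deg unfolding p by (subst proots_mult) auto
qed

text \<open>
  For an eigenvector \<open>v\<close>, the number \<open>S = v\<^sup>* M v\<close> equals \<open>z |v|\<^sup>2\<close> by the eigenvalue equation and is
  its own conjugate by symmetry of \<open>M\<close>.
\<close>
lemma symmetric_complex_eigenvalue_real:
  fixes M :: "real mat"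
  assumes M: "M \<in> carrier_mat n n"
    and sym: "\<And>i j. i < n \<Longrightarrow> j < n \<Longrightarrow> M $$ (i, j) = M $$ (j, i)"
    and ev: "eigenvalue (map_mat complex_of_real M) z"
  shows "z \<in> \<real>"
proof -
  obtain v where v: "v \<in> carrier_vec n" "v \<noteq> 0\<^sub>v n"
    and eq: "map_mat complex_of_real M *\<^sub>v v = z \<cdot>\<^sub>v v"
    using ev M unfolding eigenvalue_def eigenvector_def by auto
  have row: "(\<Sum>j<n. of_real (M $$ (i, j)) * v $ j) = z * v $ i" if "i < n" for i
  proof -
    have "(map_mat complex_of_real M *\<^sub>v v) $ i = (\<Sum>j<n. of_real (M $$ (i, j)) * v $ j)"
      using that M v(1) by (auto simp: scalar_prod_def atLeast0LessThan)
    then show ?thesis using eq that v(1) by simp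
  qed
  define S where "S = (\<Sum>i<n. \<Sum>j<n. cnj (v $ i) * of_real (M $$ (i, j)) * v $ j)"
  define N where "N = (\<Sum>i<n. (cmod (v $ i))\<^sup>2)"
  have "S = (\<Sum>i<n. cnj (v $ i) * (\<Sum>j<n. of_real (M $$ (i, j)) * v $ j))"
    by (simp add: S_def sum_distrib_left mult.assoc)
  also have "\<dots> = (\<Sum>i<n. z * of_real ((cmod (v $ i))\<^sup>2))"
    by (intro sum.cong refl, subst row) (simp_all add: complex_norm_square mult_ac del: of_real_power)
  finally have SN: "S = z * of_real N"
    by (simp add: N_def sum_distrib_left)
  have "cnj S = (\<Sum>i<n. \<Sum>j<n. cnj (v $ j) * of_real (M $$ (i, j)) * v $ i)"
    by (simp add: S_def mult_ac)
  also have "\<dots> = (\<Sum>j<n. \<Sum>i<n. cnj (v $ j) * of_real (M $$ (j, i)) * v $ i)"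
    by (subst sum.swap) (auto intro!: sum.cong simp: sym)
  finally have "cnj S = S" by (simp add: S_def)
  moreover have "N \<noteq> 0"
  proof
    assume "N = 0"
    then have "v $ i = 0" if "i < n" for i
      using that unfolding N_def by (subst (asm) sum_nonneg_eq_0_iff) auto
    then have "v = 0\<^sub>v n" using v(1) by auto
    with v(2) show False ..
  qed
  ultimately have "cnj z = z" using SN by auto
  then show ?thesis by (simp add: Reals_cnj_iff)
qed

lemma symmetric_size_proots_char_poly:
  fixes M :: "real mat"
  assumes M: "M \<in> carrier_mat n n"
    and sym: "\<And>i j. i < n \<Longrightarrow> j < n \<Longrightarrow> M $$ (i, j) = M $$ (j, i)"
  shows "size (proots (char_poly M)) = n"
proof -
  have deg: "degree (char_poly M) = n" and nz: "char_poly M \<noteq> 0"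
    using degree_monic_char_poly[OF M] by auto
  have "z \<in> \<real>" if "poly (map_poly complex_of_real (char_poly M)) z = 0" for z
  proof (rule symmetric_complex_eigenvalue_real[OF M sym])
    show "eigenvalue (map_mat complex_of_real M) z"
      using that M by (subst eigenvalue_root_char_poly[of _ n])
        (auto simp: of_real_hom.char_poly_hom[OF M])
  qed
  then show ?thesis using real_rooted_imp_size_proots[OF nz] deg by simp
qed

text \<open>
  Every term of the Leibniz expansion contains one entry from each column in \<open>I\<close>. The expansion
  is indexed by rows, so the argument runs on the transpose.
\<close>
lemma power_dvd_det:
  fixes A :: "'a::comm_ring_1 mat"
  assumes A: "A \<in> carrier_mat n n" and I: "I \<subseteq> {..<n}"
    and dvd: "\<And>i j. i < n \<Longrightarrow> j \<in> I \<Longrightarrow> d dvd A $$ (i, j)"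
  shows "d ^ card I dvd det A"
proof -
  have A': "transpose_mat A \<in> carrier_mat n n" using A by simp
  have "d ^ card I dvd (\<Prod>i = 0..<n. transpose_mat A $$ (i, p i))"
    if p: "p permutes {0..<n}" for p
  proof -
    have "d ^ card I = (\<Prod>i\<in>I. d)" by simp
    also have "\<dots> dvd (\<Prod>i\<in>I. transpose_mat A $$ (i, p i))"
    proof (rule prod_dvd_prod)
      fix j assume j: "j \<in> I"
      then have "j < n" using I by auto
      moreover from this have "p j < n" using permutes_in_image[OF p, of j] by simp
      ultimately show "d dvd transpose_mat A $$ (j, p j)" using A dvd j by simp
    qed
    also have "\<dots> dvd (\<Prod>i = 0..<n. transpose_mat A $$ (i, p i))"
      using I by (intro prod_dvd_prod_subset) auto
    finally show ?thesis .
  qed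
  then have "d ^ card I dvd det (transpose_mat A)"
    unfolding det_def'[OF A'] by (auto intro!: dvd_sum dvd_mult)
  then show ?thesis by (simp add: det_transpose[OF A])
qed

text \<open>
  The hypothesis says that the vectors \<open>e\<^sub>i - e\<^sub>i\<^sub>0\<close> with \<open>i \<in> I\<close> are eigenvectors for \<open>a\<close>. The claim
  is the instance for these vectors of the fact that the algebraic multiplicity is at least the
  geometric one. Subtracting column \<open>i0\<close> of \<open>x 1 - M\<close> from the columns in \<open>I\<close> does not change the
  determinant and makes these columns divisible by \<open>x - a\<close>. The order hypothesis makes the column
  operation \<open>U\<close> upper triangular.
\<close>
lemma power_dvd_char_poly:
  fixes M :: "'a::comm_ring_1 mat"
  assumes M: "M \<in> carrier_mat n n" and I: "I \<subseteq> {..<n}" and less: "\<And>i. i \<in> I \<Longrightarrow> i0 < i"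
    and col: "\<And>k i. k < n \<Longrightarrow> i \<in> I \<Longrightarrow>
      M $$ (k, i) - M $$ (k, i0) = a * (of_bool (k = i) - of_bool (k = i0))"
  shows "[:-a, 1:] ^ card I dvd char_poly M"
proof -
  define C where "C = char_poly_matrix M"
  define U :: "'a poly mat" where
    "U = mat n n (\<lambda>(k, i). of_bool (k = i) - of_bool (k = i0 \<and> i \<in> I))"
  have C: "C \<in> carrier_mat n n" and U: "U \<in> carrier_mat n n"
    using M by (simp_all add: C_def U_def)
  have "det U = prod_list (diag_mat U)"
    by (intro det_upper_triangular[OF _ U]) (auto simp: U_def upper_triangular_def dest: less)
  also have "\<dots> = 1"
    using less[of i0] by (auto simp: diag_mat_def U_def intro!: prod_list_neutral)
  finally have "det U = 1" .
  have "[:-a, 1:] ^ card I dvd det (C * U)"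
  proof (rule power_dvd_det[OF mult_carrier_mat[OF C U] I])
    fix k i assume k: "k < n" and i: "i \<in> I"
    then have "i < n" "i0 < n" "i \<noteq> i0" using I less by fastforce+
    have "(C * U) $$ (k, i) = (\<Sum>l<n. C $$ (k, l) * (of_bool (l = i) - of_bool (l = i0)))"
      using C U k \<open>i < n\<close> i by (simp add: scalar_prod_def atLeast0LessThan U_def)
    also have "\<dots> = (\<Sum>l<n. if l = i then C $$ (k, l) else 0) - (\<Sum>l<n. if l = i0 then C $$ (k, l) else 0)"
      by (subst sum_subtractf[symmetric]) (auto intro!: sum.cong)
    also have "\<dots> = C $$ (k, i) - C $$ (k, i0)"
      using \<open>i < n\<close> \<open>i0 < n\<close> by simp
    also have "\<dots> = [:0, 1:] * (of_bool (k = i) - of_bool (k = i0)) - [:M $$ (k, i) - M $$ (k, i0):]"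
      using M k \<open>i < n\<close> \<open>i0 < n\<close> by (simp add: C_def char_poly_matrix_def)
    also have "\<dots> = [:-a, 1:] * (of_bool (k = i) - of_bool (k = i0))"
      unfolding col[OF k i] using \<open>i \<noteq> i0\<close> by auto
    finally show "[:-a, 1:] dvd (C * U) $$ (k, i)" by (metis dvd_triv_left)
  qed
  then show ?thesis
    using \<open>det U = 1\<close> unfolding det_mult[OF C U] by (simp add: char_poly_def C_def)
qed

text \<open>
  The form in which harmonic extensions are constructed: a square system indexed by a finite set
  is solvable for every right-hand side once its kernel is trivial.
\<close>
lemma finite_linear_system_solvable:
  fixes a :: "'a \<Rightarrow> 'a \<Rightarrow> real"
  assumes "finite S"
    and kernel: "\<And>h. (\<And>x. x \<in> S \<Longrightarrow> (\<Sum>y\<in>S. a x y * h y) = 0) \<Longrightarrow> (\<And>x. x \<in> S \<Longrightarrow> h x = 0)"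
  shows "\<exists>h. \<forall>x\<in>S. (\<Sum>y\<in>S. a x y * h y) = c x"
proof -
  define n where "n = card S"
  obtain e where e: "bij_betw e {0..<n} S"
    using ex_bij_betw_nat_finite[OF assms(1)] n_def by auto
  define r where "r = the_inv_into {0..<n} e"
  have r: "r (e i) = i" if "i < n" for i
    using that e unfolding r_def bij_betw_def by (simp add: the_inv_into_f_f)
  define A where "A = mat n n (\<lambda>(i, j). a (e i) (e j))"
  have A: "A \<in> carrier_mat n n" by (simp add: A_def)
  have sum_e: "(\<Sum>y\<in>S. a x y * h y) = (\<Sum>j<n. a x (e j) * h (e j))" for x h
    using sum.reindex_bij_betw[OF e, of "\<lambda>y. a x y * h y"] by (simp add: atLeast0LessThan)
  have mv: "(A *\<^sub>v v) $ i = (\<Sum>y\<in>S. a (e i) y * v $ r y)"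
    if "v \<in> carrier_vec n" "i < n" for v i
    using that by (auto simp: A_def sum_e scalar_prod_def atLeast0LessThan r intro!: sum.cong)
  have "det A \<noteq> 0"
  proof
    assume "det A = 0"
    then obtain v where v: "v \<in> carrier_vec n" "v \<noteq> 0\<^sub>v n" "A *\<^sub>v v = 0\<^sub>v n"
      using det_0_iff_vec_prod_zero_field[OF A] by auto
    have "(\<Sum>y\<in>S. a x y * v $ r y) = 0" if "x \<in> S" for x
    proof -
      obtain i where "i < n" "x = e i" using \<open>x \<in> S\<close> bij_betw_imp_surj_on[OF e] by force
      then show ?thesis using mv[OF v(1), of i] v(3) by simp
    qed
    then have "v $ r x = 0" if "x \<in> S" for x using kernel[of "\<lambda>y. v $ r y"] that by blast
    then have "v $ i = 0" if "i < n" for i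
      using that r[OF that] e unfolding bij_betw_def by (metis atLeastLessThan_iff imageI le0)
    then have "v = 0\<^sub>v n" using v(1) by auto
    with v(2) show False ..
  qed
  then obtain B where B: "B \<in> carrier_mat n n" "A * B = 1\<^sub>m n"
    using det_non_zero_imp_unit[OF A, of "()"] unfolding Units_def ring_mat_def by auto
  define w where "w = B *\<^sub>v vec n (\<lambda>i. c (e i))"
  have w: "w \<in> carrier_vec n" using B(1) by (simp add: w_def)
  have "A *\<^sub>v w = vec n (\<lambda>i. c (e i))"
    unfolding w_def by (subst assoc_mult_mat_vec[symmetric, OF A B(1)]) (auto simp: B(2))
  then have "(\<Sum>y\<in>S. a (e i) y * w $ r y) = c (e i)" if "i < n" for i
    using mv[OF w that] that by simp
  then have "\<forall>x\<in>S. (\<Sum>y\<in>S. a x y * w $ r y) = c x"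
    using e unfolding bij_betw_def by fastforce
  then show ?thesis by (intro exI[of _ "\<lambda>y. w $ r y"])
qed

text \<open>
  Copies of an upper bound of the list come last when the list is sorted.
\<close>
lemma sorted_nth_eq_upper_bound:
  fixes xs :: "'a::linorder list"
  assumes "sorted xs" "\<And>x. x \<in> set xs \<Longrightarrow> x \<le> m"
    and "length xs - k \<le> count (mset xs) m" "k \<le> i" "i < length xs"
  shows "xs ! i = m"
proof (rule ccontr)
  assume "xs ! i \<noteq> m"
  then have "xs ! i < m" using assms(2)[of "xs ! i"] assms(5) by (simp add: less_le)
  then have "xs ! j \<noteq> m" if "j \<le> i" for j
    using sorted_nth_mono[OF assms(1) that assms(5)] by auto
  then have "{j. j < length xs \<and> m = xs ! j} \<subseteq> {Suc i..<length xs}"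
    by (force simp: not_less_eq_eq[symmetric])
  then have "card {j. j < length xs \<and> m = xs ! j} \<le> card {Suc i..<length xs}"
    by (intro card_mono) auto
  then have "count (mset xs) m \<le> length xs - Suc i"
    by (simp add: count_mset count_list_eq_length_filter length_filter_conv_card)
  then show False using assms(3-5) by simp
qed

section \<open>Harmonic functions and the Steklov matrix\<close>

lemma (in pair_graph) neighbours_commute: "y \<in> neighbours G x \<longleftrightarrow> x \<in> neighbours G y"
  using pair_sym_arcs by (auto simp: neighbours_def symmetric_def sym_def)

lemma (in pair_graph) neighbours_subset: "neighbours G x \<subseteq> pverts G"
  by (auto simp: neighbours_def dest: in_arcsD2)

lemma (in pair_graph) finite_neighbours: "finite (neighbours G x)"
  using neighbours_subset pair_finite_verts by (rule finite_subset)

lemma (in pair_graph) sum_parcs: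
  "(\<Sum>(x, y)\<in>parcs G. F x y) = (\<Sum>x\<in>pverts G. \<Sum>y\<in>neighbours G x. F x y)"
proof -
  have "parcs G = Sigma (pverts G) (neighbours G)"
    by (auto simp: neighbours_def dest: in_arcsD1)
  then show ?thesis
    using pair_finite_verts finite_neighbours by (simp add: sum.Sigma)
qed

lemma (in pair_graph) sum_parcs_swap:
  "(\<Sum>(x, y)\<in>parcs G. F x y) = (\<Sum>(x, y)\<in>parcs G. F y x)"
  using pair_sym_arcs
  by (intro sum.reindex_bij_witness[of _ "\<lambda>(x, y). (y, x)" "\<lambda>(x, y). (y, x)"])
    (auto simp: symmetric_def sym_def)

text \<open>
  Summation by parts. Each edge occurs in \<^term>\<open>parcs G\<close> with both orientations, hence the
  factor one half.
\<close>
lemma (in pair_graph) green_identity: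
  "(\<Sum>x\<in>pverts G. u x * laplacian G v x) =
     (\<Sum>(x, y)\<in>parcs G. (u x - u y) * (v x - v y)) / 2"
proof -
  have *: "(\<Sum>x\<in>pverts G. u x * laplacian G v x) = (\<Sum>(x, y)\<in>parcs G. u x * (v x - v y))"
    unfolding sum_parcs by (simp add: laplacian_def sum_distrib_left)
  also have "\<dots> = (\<Sum>(x, y)\<in>parcs G. u y * (v y - v x))"
    by (rule sum_parcs_swap)
  finally have "2 * (\<Sum>x\<in>pverts G. u x * laplacian G v x) =
      (\<Sum>(x, y)\<in>parcs G. u x * (v x - v y)) + (\<Sum>(x, y)\<in>parcs G. u y * (v y - v x))"
    using * by simp
  also have "\<dots> = (\<Sum>(x, y)\<in>parcs G. (u x - u y) * (v x - v y))"
    by (subst sum.distrib[symmetric]) (auto intro!: sum.cong simp: algebra_simps)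
  finally show ?thesis by simp
qed

lemma (in pair_graph) laplacian_cong:
  assumes "\<And>y. y \<in> pverts G \<Longrightarrow> g y = h y" "x \<in> pverts G"
  shows "laplacian G g x = laplacian G h x"
  using assms neighbours_subset unfolding laplacian_def by (intro sum.cong) auto

lemma laplacian_sum:
  "laplacian G (\<lambda>x. \<Sum>b\<in>S. c b * g b x) x = (\<Sum>b\<in>S. c b * laplacian G (g b) x)"
  unfolding laplacian_def sum_distrib_left
  by (subst sum.swap) (simp add: sum_subtractf right_diff_distrib)

lemma laplacian_diff: "laplacian G (\<lambda>x. g x - h x) x = laplacian G g x - laplacian G h x"
  by (simp add: laplacian_def sum_subtractf[symmetric] algebra_simps)

text \<open>
  Connectedness in the form of an induction principle.
\<close>
lemma (in pair_graph) connected_invariant: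
  assumes "connected (with_proj G)"
    and "P a" "a \<in> pverts G" "b \<in> pverts G"
    and step: "\<And>x y. (x, y) \<in> parcs G \<Longrightarrow> P x \<Longrightarrow> P y"
  shows "P b"
proof -
  have "strongly_connected (with_proj G)"
    using symmetric_connected_imp_strongly_connected pair_sym_arcs assms(1) by blast
  then have "a \<rightarrow>\<^sup>*\<^bsub>with_proj G\<^esub> b"
    using assms(3,4) unfolding strongly_connected_def by simp
  then show ?thesis
    by (induction rule: reachable_induct) (use assms(2) step in auto)
qed

locale graph_with_boundary = pair_graph G for G :: "'a::linorder pair_pre_digraph" +
  fixes B :: "'a set"
  assumes connected: "connected (with_proj G)"
    and boundary_subset: "B \<subseteq> pverts G"
    and boundary_nonempty: "B \<noteq> {}"
begin

definition harmonic :: "('a \<Rightarrow> real) \<Rightarrow> bool" where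
  "harmonic h \<longleftrightarrow> (\<forall>x\<in>pverts G - B. laplacian G h x = 0)"

lemma finite_boundary: "finite B"
  using boundary_subset pair_finite_verts by (rule finite_subset)

lemma sum_mult_laplacian_harmonic:
  assumes "harmonic h"
  shows "(\<Sum>x\<in>pverts G. u x * laplacian G h x) = (\<Sum>x\<in>B. u x * laplacian G h x)"
  using assms boundary_subset pair_finite_verts unfolding harmonic_def
  by (intro sum.mono_neutral_right) auto

text \<open>
  By Green's identity the Dirichlet energy of \<open>h\<close> is zero, so \<open>h\<close> is constant along edges, and a
  boundary vertex is connected to every vertex.
\<close>
lemma harmonic_zero:
  assumes "harmonic h" and B0: "\<And>x. x \<in> B \<Longrightarrow> h x = 0" and "x \<in> pverts G"
  shows "h x = 0"
proof -
  have "(\<Sum>(x, y)\<in>parcs G. (h x - h y) * (h x - h y)) = 0"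
    using green_identity[of h h] sum_mult_laplacian_harmonic[OF assms(1), of h] B0 by simp
  then have *: "h x = h y" if "(x, y) \<in> parcs G" for x y
    using that pair_finite_arcs by (subst (asm) sum_nonneg_eq_0_iff) auto
  obtain b where "b \<in> B" using boundary_nonempty by blast
  then show ?thesis
    using connected_invariant[OF connected, of "\<lambda>x. h x = 0" b x] B0 * assms(3) boundary_subset
    by auto
qed

text \<open>
  The conditions on a harmonic extension form a linear system with one equation and one unknown
  per vertex. Its kernel is trivial by \<open>harmonic_zero\<close>, so uniqueness yields existence.
\<close>
lemma ex_harmonic: "\<exists>h. harmonic h \<and> (\<forall>x\<in>B. h x = f x)"
proof -
  define a where "a x y = (if x \<in> B then of_bool (y = x)
    else of_bool (y = x) * real (card (neighbours G x)) - of_bool (y \<in> neighbours G x))" for x y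
  have a: "(\<Sum>y\<in>pverts G. a x y * h y) = (if x \<in> B then h x else laplacian G h x)"
    if x: "x \<in> pverts G" for x h
  proof -
    have delta: "(\<Sum>y\<in>pverts G. of_bool (y = x) * (c * h y)) = c * h x" for c :: real
      using x pair_finite_verts by (subst sum.mono_neutral_right[of _ "{x}"]) auto
    have "(\<Sum>y\<in>pverts G. of_bool (y \<in> neighbours G x) * h y) = (\<Sum>y\<in>neighbours G x. h y)"
      using pair_finite_verts neighbours_subset by (intro sum.mono_neutral_cong_right) auto
    then show ?thesis
      using delta[of 1] delta[of "real (card (neighbours G x))"]
      by (simp add: a_def laplacian_def left_diff_distrib sum_subtractf mult.assoc)
  qed
  have "\<exists>h. \<forall>x\<in>pverts G. (\<Sum>y\<in>pverts G. a x y * h y) = (if x \<in> B then f x else 0)"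
  proof (rule finite_linear_system_solvable[OF pair_finite_verts])
    fix h x
    assume h: "\<And>x. x \<in> pverts G \<Longrightarrow> (\<Sum>y\<in>pverts G. a x y * h y) = 0" and "x \<in> pverts G"
    show "h x = 0"
    proof (rule harmonic_zero)
      show "harmonic h" using h a unfolding harmonic_def by (metis DiffD1 DiffD2)
      show "h x = 0" if "x \<in> B" for x using h[of x] a[of x] that boundary_subset by auto
    qed fact
  qed
  then obtain h where h: "\<And>x. x \<in> pverts G \<Longrightarrow>
      (\<Sum>y\<in>pverts G. a x y * h y) = (if x \<in> B then f x else 0)" by blast
  have "harmonic h" using h a unfolding harmonic_def by (metis DiffD1 DiffD2)
  moreover have "\<forall>x\<in>B. h x = f x" using h a boundary_subset by (metis subsetD)
  ultimately show ?thesis by blast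
qed

lemma harmonic_unique:
  assumes "harmonic g" "harmonic h" "\<And>x. x \<in> B \<Longrightarrow> g x = h x" "x \<in> pverts G"
  shows "g x = h x"
  using harmonic_zero[of "\<lambda>x. g x - h x" x] assms
  by (auto simp: harmonic_def laplacian_diff)

lemma harmonic_extension_eq:
  assumes "harmonic h" "\<And>x. x \<in> B \<Longrightarrow> h x = f x"
  shows "harmonic_extension G B f = restrict h (pverts G)"
  unfolding harmonic_extension_def
proof (rule the_equality)
  have "laplacian G (restrict h (pverts G)) x = laplacian G h x" if "x \<in> pverts G" for x
    using that by (rule laplacian_cong[rotated]) simp
  then show "restrict h (pverts G) \<in> extensional (pverts G) \<and>
      (\<forall>x\<in>B. restrict h (pverts G) x = f x) \<and>
      (\<forall>x\<in>pverts G - B. laplacian G (restrict h (pverts G)) x = 0)"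
    using assms boundary_subset by (auto simp: harmonic_def)
next
  fix g
  assume g: "g \<in> extensional (pverts G) \<and> (\<forall>x\<in>B. g x = f x) \<and>
    (\<forall>x\<in>pverts G - B. laplacian G g x = 0)"
  then have "g x = h x" if "x \<in> pverts G" for x
    using that assms by (intro harmonic_unique[of g h x]) (auto simp: harmonic_def)
  then show "g = restrict h (pverts G)"
    using g by (auto simp: fun_eq_iff extensional_def restrict_def)
qed

lemma steklov_operator_eq:
  assumes "harmonic h" "\<And>x. x \<in> B \<Longrightarrow> h x = f x" "x \<in> B"
  shows "steklov_operator G B f x = laplacian G h x"
proof -
  have "laplacian G (restrict h (pverts G)) x = laplacian G h x"
    by (rule laplacian_cong) (use assms(3) boundary_subset in auto)
  then show ?thesis
    using assms by (simp add: steklov_operator_def harmonic_extension_eq[OF assms(1,2)])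
qed

abbreviation "M \<equiv> steklov_matrix G B"
abbreviation "bs \<equiv> sorted_list_of_set B"

lemma steklov_matrix_carrier: "M \<in> carrier_mat (card B) (card B)"
  by (simp add: steklov_matrix_def Let_def)

lemma bij_betw_bs: "bij_betw (nth bs) {..<card B} B"
  using finite_boundary by (intro bij_betw_nth) auto

lemma bs_in_boundary: "i < card B \<Longrightarrow> bs ! i \<in> B"
  using bij_betw_bs by (auto simp: bij_betw_def)

lemma ex_harmonic_vec:
  fixes v :: "real vec"
  shows "\<exists>h. harmonic h \<and> (\<forall>i<card B. h (bs ! i) = v $ i)"
proof -
  define r where "r = the_inv_into {..<card B} (nth bs)"
  have "r (bs ! i) = i" if "i < card B" for i
    using that bij_betw_bs unfolding r_def bij_betw_def by (simp add: the_inv_into_f_f)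
  then show ?thesis
    using ex_harmonic[of "\<lambda>x. v $ r x"] bs_in_boundary by auto
qed

text \<open>
  The columns of the Steklov matrix are the normal derivatives of the harmonic functions with
  boundary value one at a single boundary vertex.
\<close>
lemma ex_harmonic_unit:
  assumes "j < card B"
  obtains h where "harmonic h" "\<And>x. x \<in> B \<Longrightarrow> h x = of_bool (x = bs ! j)"
    "\<And>i. i < card B \<Longrightarrow> M $$ (i, j) = laplacian G h (bs ! i)"
proof -
  obtain h where h: "harmonic h" "\<forall>x\<in>B. h x = of_bool (x = bs ! j)"
    using ex_harmonic[of "\<lambda>x. of_bool (x = bs ! j)"] by blast
  moreover have "M $$ (i, j) = laplacian G h (bs ! i)" if "i < card B" for i
    using assms that h bs_in_boundary[OF that]
    by (simp add: steklov_matrix_def Let_def) (rule steklov_operator_eq; simp)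
  ultimately show ?thesis using that by blast
qed

text \<open>
  Green's identity expresses both entries as the Dirichlet inner product of the two harmonic
  extensions.
\<close>
lemma steklov_matrix_symmetric:
  assumes "i < card B" "j < card B"
  shows "M $$ (i, j) = M $$ (j, i)"
proof -
  obtain g where g: "harmonic g" "\<And>x. x \<in> B \<Longrightarrow> g x = of_bool (x = bs ! i)"
    "M $$ (j, i) = laplacian G g (bs ! j)"
    using ex_harmonic_unit[OF assms(1)] assms(2) by metis
  obtain h where h: "harmonic h" "\<And>x. x \<in> B \<Longrightarrow> h x = of_bool (x = bs ! j)"
    "M $$ (i, j) = laplacian G h (bs ! i)"
    using ex_harmonic_unit[OF assms(2)] assms(1) by metis
  have delta: "(\<Sum>x\<in>B. u x * F x) = F b"
    if "\<And>x. x \<in> B \<Longrightarrow> u x = of_bool (x = b)" "b \<in> B" for u F :: "'a \<Rightarrow> real" and b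
    using that finite_boundary by (subst sum.mono_neutral_right[of _ "{b}"]) auto
  have "M $$ (i, j) = (\<Sum>x\<in>pverts G. g x * laplacian G h x)"
    using delta[OF g(2)] bs_in_boundary assms h sum_mult_laplacian_harmonic[OF h(1), of g] by simp
  also have "\<dots> = (\<Sum>x\<in>pverts G. h x * laplacian G g x)"
    by (simp add: green_identity mult.commute)
  also have "\<dots> = M $$ (j, i)"
    using delta[OF h(2)] bs_in_boundary assms g sum_mult_laplacian_harmonic[OF g(1), of h] by simp
  finally show ?thesis .
qed

text \<open>
  The matrix represents the operator: applied to the boundary values of a harmonic function it
  yields the normal derivative. The sum \<open>s\<close> of the columns' harmonic functions, weighted by \<open>v\<close>,
  coincides with \<open>h\<close> by uniqueness.
\<close>
lemma steklov_matrix_mult_vec: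
  assumes "harmonic h" and v: "v \<in> carrier_vec (card B)"
    and vh: "\<And>i. i < card B \<Longrightarrow> h (bs ! i) = v $ i" and i: "i < card B"
  shows "(M *\<^sub>v v) $ i = laplacian G h (bs ! i)"
proof -
  have "\<exists>g. \<forall>j<card B. harmonic (g j) \<and> (\<forall>x\<in>B. g j x = of_bool (x = bs ! j)) \<and>
      (\<forall>i<card B. M $$ (i, j) = laplacian G (g j) (bs ! i))"
    by (intro choice) (metis ex_harmonic_unit)
  then obtain g where g: "\<And>j. j < card B \<Longrightarrow> harmonic (g j)"
      "\<And>j x. j < card B \<Longrightarrow> x \<in> B \<Longrightarrow> g j x = of_bool (x = bs ! j)"
      "\<And>i j. i < card B \<Longrightarrow> j < card B \<Longrightarrow> M $$ (i, j) = laplacian G (g j) (bs ! i)"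
    by blast
  define s where "s = (\<lambda>x. \<Sum>j<card B. v $ j * g j x)"
  have "harmonic s"
    using g(1) by (auto simp: harmonic_def s_def laplacian_sum)
  moreover have "s x = h x" if "x \<in> B" for x
  proof -
    obtain k where k: "k < card B" "x = bs ! k"
      using \<open>x \<in> B\<close> bij_betw_imp_surj_on[OF bij_betw_bs] by force
    have "s x = (\<Sum>j<card B. if j = k then v $ k else 0)"
      unfolding s_def
      by (intro sum.cong)
        (use g(2) that k bij_betw_bs in \<open>auto simp: bij_betw_def inj_on_def\<close>)
    then show ?thesis using k vh by simp
  qed
  ultimately have "s x = h x" if "x \<in> pverts G" for x
    using harmonic_unique[OF _ assms(1)] that by blast
  then have "laplacian G h (bs ! i) = laplacian G s (bs ! i)"
    using bs_in_boundary[OF i] boundary_subset by (intro laplacian_cong) auto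
  also have "\<dots> = (\<Sum>j<card B. v $ j * M $$ (i, j))"
    using g(3) i by (simp add: s_def laplacian_sum)
  also have "\<dots> = (M *\<^sub>v v) $ i"
    using v i steklov_matrix_carrier
    by (auto simp: scalar_prod_def atLeast0LessThan mult.commute intro!: sum.cong)
  finally show ?thesis ..
qed

text \<open>
  The characteristic polynomial of a real symmetric matrix splits over the reals, so the list of
  its real roots is long enough for every index up to \<^term>\<open>card B\<close> to denote an eigenvalue.
\<close>
lemma length_steklov_eigenvalues: "length (steklov_eigenvalues G B) = card B"
  using symmetric_size_proots_char_poly[OF steklov_matrix_carrier steklov_matrix_symmetric]
  unfolding steklov_eigenvalues_def by (metis mset_sorted_list_of_multiset size_mset)

lemma steklov_eigenvalues_eigenfunction:
  assumes "x \<in> set (steklov_eigenvalues G B)"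
  obtains h where "harmonic h" "\<exists>b\<in>B. h b \<noteq> 0" "\<And>b. b \<in> B \<Longrightarrow> laplacian G h b = x * h b"
proof -
  have "char_poly M \<noteq> 0" using degree_monic_char_poly[OF steklov_matrix_carrier] by auto
  then have "eigenvalue M x"
    using assms eigenvalue_root_char_poly[OF steklov_matrix_carrier]
    by (simp add: steklov_eigenvalues_def)
  then obtain v where v: "v \<in> carrier_vec (card B)" "v \<noteq> 0\<^sub>v (card B)" "M *\<^sub>v v = x \<cdot>\<^sub>v v"
    using steklov_matrix_carrier unfolding eigenvalue_def eigenvector_def by auto
  obtain h where h: "harmonic h" "\<forall>i<card B. h (bs ! i) = v $ i"
    using ex_harmonic_vec[of v] by blast
  show ?thesis
  proof (rule that[OF h(1)])
    show "\<exists>b\<in>B. h b \<noteq> 0"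
    proof (rule ccontr)
      assume "\<not> ?thesis"
      then have "v $ i = 0" if "i < card B" for i
        using that h(2) bs_in_boundary by metis
      then have "v = 0\<^sub>v (card B)" using v(1) by auto
      with v(2) show False ..
    qed
    show "laplacian G h b = x * h b" if "b \<in> B" for b
    proof -
      obtain k where k: "k < card B" "b = bs ! k"
        using \<open>b \<in> B\<close> bij_betw_imp_surj_on[OF bij_betw_bs] by force
      then show ?thesis
        using steklov_matrix_mult_vec[OF h(1) v(1) _ k(1)] h(2) v(1,3) by auto
    qed
  qed
qed

end

section \<open>The bound on the eigenvalues and the multiplicity of one\<close>

text \<open>
  Two adjacent leaves would form a connected component of their own, and the graph would have only
  two vertices.
\<close>
lemma (in pair_graph) leaf_neighbour_not_leaf:
  assumes "connected (with_proj G)" "3 \<le> card (pverts G)"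
    and x: "x \<in> leaves G" and y: "y \<in> neighbours G x"
  shows "y \<notin> leaves G"
proof
  assume "y \<in> leaves G"
  moreover have "x \<in> neighbours G y" using y neighbours_commute by blast
  ultimately have N: "neighbours G x = {y}" "neighbours G y = {x}"
    using x y by (auto simp: leaves_def card_1_singleton_iff)
  have "pverts G \<subseteq> {x, y}"
  proof
    fix z assume "z \<in> pverts G"
    then show "z \<in> {x, y}"
      using connected_invariant[OF assms(1), of "\<lambda>z. z \<in> {x, y}" x z] x N
      by (auto simp: leaves_def neighbours_def)
  qed
  then have "card (pverts G) \<le> card {x, y}" by (intro card_mono) auto
  also have "\<dots> \<le> 2" by (simp add: card_insert_if)
  finally show False using assms(2) by simp
qed

text \<open>
  Let \<open>h\<close> be the harmonic extension of an eigenfunction and \<open>S\<close> the sum of \<open>h\<^sup>2\<close> over the leaves. By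
  Green's identity the Dirichlet energy of \<open>h\<close> is \<open>\<sigma> S\<close>. Along the edge at a leaf \<open>b\<close> the function \<open>h\<close>
  drops by its normal derivative \<open>\<sigma> h b\<close>. Distinct leaves have distinct edges, as no two leaves are
  adjacent, so these edges contribute \<open>\<sigma>\<^sup>2 S\<close> to the energy. Hence \<open>\<sigma>\<^sup>2 \<le> \<sigma>\<close>.
\<close>
lemma steklov_eigenvalues_leaves_le_1:
  fixes G :: "'a::linorder pair_pre_digraph"
  assumes "pair_graph G" "connected (with_proj G)" "3 \<le> card (pverts G)" "leaves G \<noteq> {}"
    and \<sigma>: "\<sigma> \<in> set (steklov_eigenvalues G (leaves G))"
  shows "\<sigma> \<le> 1"
proof -
  interpret pair_graph G by fact
  interpret graph_with_boundary G "leaves G"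
    using assms by unfold_locales (auto simp: leaves_def)
  obtain h where h: "harmonic h" "\<exists>b\<in>leaves G. h b \<noteq> 0"
      "\<And>b. b \<in> leaves G \<Longrightarrow> laplacian G h b = \<sigma> * h b"
    using steklov_eigenvalues_eigenfunction[OF \<sigma>] by blast
  define S where "S = (\<Sum>b\<in>leaves G. (h b)\<^sup>2)"
  define F where "F = (\<lambda>(x, y). (h x - h y)\<^sup>2)"
  have S: "S > 0"
  proof -
    obtain b where "b \<in> leaves G" "h b \<noteq> 0" using h(2) by blast
    then show ?thesis
      unfolding S_def using finite_boundary by (intro sum_pos2[of _ b]) auto
  qed
  have energy: "2 * (\<sigma> * S) = sum F (parcs G)"
  proof -
    have "\<sigma> * S = (\<Sum>x\<in>pverts G. h x * laplacian G h x)"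
      by (simp add: sum_mult_laplacian_harmonic[OF h(1)] h(3) S_def sum_distrib_left
          power2_eq_square mult_ac)
    then show ?thesis by (simp add: green_identity F_def power2_eq_square)
  qed
  define q where "q = (\<lambda>b. THE y. y \<in> neighbours G b)"
  have q: "neighbours G b = {q b}" if "b \<in> leaves G" for b
  proof -
    obtain y where "neighbours G b = {y}"
      using \<open>b \<in> leaves G\<close> by (auto simp: leaves_def card_1_singleton_iff)
    then show ?thesis by (simp add: q_def)
  qed
  have q_arc: "(b, q b) \<in> parcs G" "(q b, b) \<in> parcs G" if "b \<in> leaves G" for b
    using q[OF that] neighbours_commute[of b "q b"] by (auto simp: neighbours_def)
  have F_q: "F (b, q b) = \<sigma>\<^sup>2 * (h b)\<^sup>2" "F (q b, b) = \<sigma>\<^sup>2 * (h b)\<^sup>2" if "b \<in> leaves G" for b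
  proof -
    have "h b - h (q b) = \<sigma> * h b"
      using h(3)[OF that] q[OF that] by (simp add: laplacian_def)
    then show "F (b, q b) = \<sigma>\<^sup>2 * (h b)\<^sup>2" "F (q b, b) = \<sigma>\<^sup>2 * (h b)\<^sup>2"
      by (simp_all add: F_def power2_commute[of "h (q b)"] power_mult_distrib)
  qed
  \<comment> \<open>The arcs leaving and entering leaves. They are disjoint because no two leaves are adjacent.\<close>
  define A where "A = (\<lambda>b. (b, q b)) ` leaves G"
  define A' where "A' = (\<lambda>b. (q b, b)) ` leaves G"
  have sums: "sum F A = \<sigma>\<^sup>2 * S" "sum F A' = \<sigma>\<^sup>2 * S"
    unfolding A_def A'_def S_def sum_distrib_left
    by (subst sum.reindex; auto simp: inj_on_def F_q intro!: sum.cong)+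
  have "q b \<notin> leaves G" if "b \<in> leaves G" for b
    using leaf_neighbour_not_leaf[OF assms(2,3) that] q[OF that] by simp
  then have "A \<inter> A' = {}"
    by (auto simp: A_def A'_def)
  then have "\<sigma>\<^sup>2 * S + \<sigma>\<^sup>2 * S = sum F (A \<union> A')"
    using sums finite_boundary by (subst sum.union_disjoint) (auto simp: A_def A'_def)
  also have "\<dots> \<le> sum F (parcs G)"
    using pair_finite_arcs q_arc by (intro sum_mono2) (auto simp: A_def A'_def F_def)
  finally have "\<sigma>\<^sup>2 * S \<le> \<sigma> * S" using energy by linarith
  then have "\<sigma>\<^sup>2 \<le> \<sigma>" using S by simp
  then show "\<sigma> \<le> 1"
    using mult_strict_left_mono[of 1 \<sigma> \<sigma>] by (cases "1 < \<sigma>") (auto simp: power2_eq_square)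
qed

text \<open>
  If \<open>i\<close> and \<open>j\<close> are pendant at the same interior vertex \<open>c\<close>, then \<open>e\<^sub>i - e\<^sub>j\<close> extended by zero is
  harmonic: the two contributions cancel at \<open>c\<close>, and no other vertex sees them. Its normal
  derivative is the function itself. Fixing one of the pendant vertices as \<open>j\<close> gives \<open>card P - 1\<close>
  independent eigenfunctions for the eigenvalue \<open>1\<close>.
\<close>
lemma (in graph_with_boundary) order_1_char_poly_pendant:
  assumes P: "P \<subseteq> B" "P \<noteq> {}" and c: "c \<notin> B"
    and N: "\<And>p. p \<in> P \<Longrightarrow> neighbours G p = {c}"
  shows "card P - 1 \<le> order 1 (char_poly M)"
proof -
  define I where "I = {i \<in> {..<card B}. bs ! i \<in> P}"
  \<comment> \<open>The least index, as the column operation of \<open>power_dvd_char_poly\<close> requires.\<close>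
  define i0 where "i0 = Min I"
  have "nth bs ` I = P"
  proof (intro equalityI subsetI)
    fix x assume "x \<in> P"
    moreover from this obtain k where "k < card B" "x = bs ! k"
      using P(1) bij_betw_imp_surj_on[OF bij_betw_bs] by force
    ultimately show "x \<in> nth bs ` I" by (simp add: I_def)
  qed (auto simp: I_def)
  then have "bij_betw (nth bs) I P"
    by (intro bij_betw_subset[OF bij_betw_bs]) (auto simp: I_def)
  then have card_I: "card I = card P" and "I \<noteq> {}"
    using P(2) bij_betw_same_card by (blast, auto simp: bij_betw_def)
  moreover have "finite I" by (simp add: I_def)
  ultimately have i0: "i0 \<in> I" "\<And>i. i \<in> I - {i0} \<Longrightarrow> i0 < i"
    by (auto simp: i0_def less_le)
  have bs_eq: "bs ! i = bs ! j \<longleftrightarrow> i = j" if "i < card B" "j < card B" for i j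
    using that bij_betw_bs by (auto simp: bij_betw_def inj_on_def)
  have col: "M $$ (k, i) - M $$ (k, i0) = 1 * (of_bool (k = i) - of_bool (k = i0))"
    if k: "k < card B" and i: "i \<in> I - {i0}" for k i
  proof -
    define h :: "'a \<Rightarrow> real" where "h = (\<lambda>x. of_bool (x = bs ! i) - of_bool (x = bs ! i0))"
    have iB: "i < card B" "i0 < card B" "bs ! i \<in> P" "bs ! i0 \<in> P" "i \<noteq> i0"
      using i i0(1) by (auto simp: I_def)
    have neigh: "(\<Sum>y\<in>neighbours G x. h y) = 0" for x
    proof (cases "x = c")
      case True
      then have "bs ! i \<in> neighbours G x" "bs ! i0 \<in> neighbours G x"
        using N iB neighbours_commute by blast+
      then show ?thesis
        using finite_neighbours[of x] by (simp add: h_def sum_subtractf of_bool_def)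
    next
      case False
      then have "h y = 0" if "y \<in> neighbours G x" for y
        using that N iB neighbours_commute[of y x] by (auto simp: h_def)
      then show ?thesis by simp
    qed
    have lap: "laplacian G h x = real (card (neighbours G x)) * h x" for x
      by (simp add: laplacian_def sum_subtractf neigh)
    have "harmonic h"
    proof -
      have "h x = 0" if "x \<notin> B" for x
        using that P(1) iB(3,4) by (auto simp: h_def)
      then show ?thesis by (simp add: harmonic_def lap)
    qed
    define v where "v = vec (card B) (\<lambda>l. h (bs ! l))"
    have "(M *\<^sub>v v) $ k = laplacian G h (bs ! k)"
      by (rule steklov_matrix_mult_vec[OF \<open>harmonic h\<close> _ _ k]) (auto simp: v_def)
    also have "\<dots> = h (bs ! k)"
    proof (cases "bs ! k \<in> P")
      case True
      then show ?thesis by (simp add: lap N)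
    next
      case False
      then have "h (bs ! k) = 0" using iB(3,4) by (auto simp: h_def)
      then show ?thesis by (simp add: lap)
    qed
    also have "\<dots> = of_bool (k = i) - of_bool (k = i0)"
      using bs_eq k iB by (simp add: h_def)
    finally have "(M *\<^sub>v v) $ k = of_bool (k = i) - of_bool (k = i0)" .
    moreover have "(M *\<^sub>v v) $ k = (\<Sum>l<card B. M $$ (k, l) * (of_bool (l = i) - of_bool (l = i0)))"
      using k iB steklov_matrix_carrier bs_eq
      by (auto simp: scalar_prod_def atLeast0LessThan v_def h_def intro!: sum.cong)
    moreover have "\<dots> = (\<Sum>l<card B. if l = i then M $$ (k, l) else 0) -
        (\<Sum>l<card B. if l = i0 then M $$ (k, l) else 0)"
      by (subst sum_subtractf[symmetric]) (auto intro!: sum.cong)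
    ultimately show ?thesis using iB by simp
  qed
  have "[:- 1, 1:] ^ card (I - {i0}) dvd char_poly M"
  proof (rule power_dvd_char_poly[OF steklov_matrix_carrier _ i0(2) col])
    show "I - {i0} \<subseteq> {..<card B}" by (auto simp: I_def)
  qed
  moreover have "char_poly M \<noteq> 0"
    using degree_monic_char_poly[OF steklov_matrix_carrier] by auto
  ultimately show ?thesis
    using i0(1) card_I \<open>finite I\<close> by (simp add: order_divides)
qed

section \<open>Brooms\<close>

text \<open>
  A tree with root \<open>r\<close> given by its parent function, under the assumption below that every parent
  has a larger number than its children. With this numbering a cycle can be excluded by looking at
  its least vertex.
\<close>
definition parent_tree :: "nat \<Rightarrow> (nat \<Rightarrow> nat) \<Rightarrow> nat pair_pre_digraph" where
  "parent_tree r p = \<lparr>pverts = {..r}, parcs = {(i, j). i < r \<and> j = p i \<or> j < r \<and> i = p j}\<rparr>"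

lemma pawalk_verts_cas: "pcas u q v \<Longrightarrow> pawalk_verts u q = u # map snd q"
  by (induction u q v rule: pcas.induct) auto

lemma cas_fst_hd: "pcas u q v \<Longrightarrow> q \<noteq> [] \<Longrightarrow> fst (hd q) = u"
  by (cases q) auto

lemma cas_snd_last: "pcas u q v \<Longrightarrow> q \<noteq> [] \<Longrightarrow> snd (last q) = v"
  by (induction u q v rule: pcas.induct) auto

lemma cas_consecutive: "pcas u q v \<Longrightarrow> Suc i < length q \<Longrightarrow> fst (q ! Suc i) = snd (q ! i)"
proof (induction u q v arbitrary: i rule: pcas.induct)
  case (2 u e es v)
  then show ?case
    using cas_fst_hd[of "snd e" es v] by (cases i) (auto simp: hd_conv_nth)
qed simp

context
  fixes r :: nat and p :: "nat \<Rightarrow> nat"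
  assumes parent: "\<And>i. i < r \<Longrightarrow> i < p i \<and> p i \<le> r"
begin

lemma pair_graph_parent_tree: "pair_graph (parent_tree r p)"
proof
  show "finite (parcs (parent_tree r p))"
  proof (rule finite_subset)
    show "parcs (parent_tree r p) \<subseteq> {..r} \<times> {..r}"
      using parent by (auto simp: parent_tree_def less_imp_le)
  qed simp
next
  show "fst e \<noteq> snd e" if "e \<in> parcs (parent_tree r p)" for e
    using that parent[of "fst e"] parent[of "snd e"] by (auto simp: parent_tree_def)
qed (use parent in \<open>auto simp: parent_tree_def less_imp_le symmetric_def sym_def\<close>)

text \<open>
  Parents are larger than their children, so iterating \<open>p\<close> leads from every vertex to the root.
\<close>
lemma connected_parent_tree: "connected (with_proj (parent_tree r p))"
proof -
  let ?G = "parent_tree r p"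
  interpret pair_graph ?G by (rule pair_graph_parent_tree)
  have root: "i \<rightarrow>\<^sup>*\<^bsub>with_proj ?G\<^esub> r" if "i \<le> r" for i
    using that
  proof (induction "r - i" arbitrary: i rule: less_induct)
    case less
    show ?case
    proof (cases "i = r")
      case True
      moreover have "r \<in> verts (with_proj ?G)" by (simp add: parent_tree_def)
      ultimately show ?thesis by auto
    next
      case False
      then have i: "i < r" using less.prems by simp
      then have "p i \<rightarrow>\<^sup>*\<^bsub>with_proj ?G\<^esub> r"
        using parent[OF i] by (intro less.hyps) auto
      moreover have "(i, p i) \<in> parcs ?G" using i by (simp add: parent_tree_def)
      ultimately show ?thesis using adj_reachable_trans by auto
    qed
  qed
  have "strongly_connected (with_proj ?G)"
  proof (rule strongly_connectedI)
    fix u v assume "u \<in> verts (with_proj ?G)" "v \<in> verts (with_proj ?G)"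
    then show "u \<rightarrow>\<^sup>*\<^bsub>with_proj ?G\<^esub> v"
      using reachable_trans[OF root[of u] symmetric_reachable'[OF root[of v]]]
      by (simp add: parent_tree_def)
  qed (simp add: parent_tree_def)
  then show ?thesis
    by (auto simp: connected_def strongly_connected_def reachable_mk_symmetric_eq[OF pair_sym_arcs])
qed

text \<open>
  Both neighbours of the least vertex of a cycle are larger than it, so both are its parent. On a
  cycle of length at least three they are distinct vertices.
\<close>
lemma undirected_tree_parent_tree: "undirected_tree (parent_tree r p)"
  unfolding undirected_tree_def
proof (intro conjI notI pair_graph_parent_tree connected_parent_tree)
  let ?G = "parent_tree r p"
  interpret pair_graph ?G by (rule pair_graph_parent_tree)
  assume "\<exists>q. pre_digraph.cycle (with_proj ?G) q \<and> 3 \<le> length q"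
  then obtain q u where q: "awalk u q u" "distinct (tl (pawalk_verts u q))" "3 \<le> length q"
    by (auto simp: cycle_def)
  define n where "n = length q"
  \<comment> \<open>The vertices of the cycle, indexed periodically.\<close>
  define w where "w i = snd (q ! (i mod n))" for i
  have n: "3 \<le> n" "n > 0" using q(3) by (auto simp: n_def)
  have cas: "pcas u q u" and arcs: "set q \<subseteq> parcs ?G" and "q \<noteq> []"
    using q(1,3) by (auto simp: awalk_def)
  note walk = cas_consecutive[OF cas] cas_fst_hd[OF cas \<open>q \<noteq> []\<close>]
    cas_snd_last[OF cas \<open>q \<noteq> []\<close>] pawalk_verts_cas[OF cas]
  have step: "(w i, w (Suc i)) \<in> parcs ?G" for i
  proof -
    have "fst (q ! (Suc i mod n)) = snd (q ! (i mod n))"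
    proof (cases "Suc (i mod n) = n")
      case True
      then have "i mod n = length q - 1" by (simp add: n_def)
      moreover have "Suc i mod n = 0" using True by (simp add: mod_Suc)
      ultimately show ?thesis
        using walk(2,3) \<open>q \<noteq> []\<close> by (simp add: hd_conv_nth last_conv_nth)
    next
      case False
      then have "Suc (i mod n) < n" using n(2) by (metis Suc_lessI mod_less_divisor)
      then show ?thesis using walk(1) False by (simp add: mod_Suc n_def)
    qed
    then have "(w i, w (Suc i)) = q ! (Suc i mod n)" by (simp add: w_def prod_eq_iff)
    also have "\<dots> \<in> set q" using n(2) by (intro nth_mem) (simp add: n_def)
    finally show ?thesis using arcs by blast
  qed
  have inj: "i mod n = j mod n" if "w i = w j" for i j
  proof -
    have "distinct (map snd q)" using q(2) walk(4) by simp
    moreover have "map snd q ! (i mod n) = map snd q ! (j mod n)"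
      using that n(2) by (simp add: w_def n_def)
    ultimately show ?thesis using n(2) by (subst (asm) nth_eq_iff_index_eq) (auto simp: n_def)
  qed
  obtain m where m: "\<And>i. w m \<le> w i"
    using ex_has_least_nat[of "\<lambda>_. True" 0 w] by auto
  have succ: "y = p (w m)" if "(w m, y) \<in> parcs ?G" "w m \<le> y" for y
    using that parent[of y] by (auto simp: parent_tree_def)
  have "w (Suc m) = p (w m)"
    using succ step m by blast
  \<comment> \<open>The index \<open>m + n - 1\<close> is the cyclic predecessor of \<open>m\<close>.\<close>
  moreover have "w (m + n - 1) = p (w m)"
  proof (rule succ)
    have "w (Suc (m + n - 1)) = w m" using n(2) by (simp add: w_def)
    then have "(w (m + n - 1), w m) \<in> parcs ?G" using step[of "m + n - 1"] by simp
    then show "(w m, w (m + n - 1)) \<in> parcs ?G" by (auto simp: parent_tree_def)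
  qed (rule m)
  ultimately have "(m + 1) mod n = (m + n - 1) mod n"
    using inj[of "Suc m" "m + n - 1"] by simp
  then have "n dvd (m + n - 1) - (m + 1)" using n by (intro mod_eq_dvd_iff_nat[THEN iffD1]) auto
  then have "n dvd n - 2" using n by simp
  then show False using n by (auto dest!: dvd_imp_le)
qed

end

text \<open>
  The vertices \<open>0, ..., b - 2\<close> are pendant at the centre \<open>b - 1\<close>, and a handle
  \<open>b - 1, b, ..., n - 1\<close> leads from the centre to the last leaf.
\<close>
definition broom :: "nat \<Rightarrow> nat \<Rightarrow> nat pair_pre_digraph" where
  "broom b n = parent_tree (n - 1) (\<lambda>i. max (i + 1) (b - 1))"

context
  fixes b n :: nat
  assumes b: "3 \<le> b" and n: "b + 1 \<le> n"
begin

lemma undirected_tree_broom: "undirected_tree (broom b n)"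
  unfolding broom_def using b n by (intro undirected_tree_parent_tree) auto

lemma pverts_broom: "pverts (broom b n) = {..<n}"
  using n by (auto simp: broom_def parent_tree_def)

lemma neighbours_broom_pendant: "i < b - 1 \<Longrightarrow> neighbours (broom b n) i = {b - 1}"
  using b n by (auto simp: broom_def parent_tree_def neighbours_def max_def)

lemma leaves_broom: "leaves (broom b n) = insert (n - 1) {..<b - 1}"
proof -
  let ?N = "neighbours (broom b n)"
  have last: "?N (n - 1) = {n - 2}"
    using b n by (auto simp: broom_def parent_tree_def neighbours_def max_def)
  have inner: "x \<notin> leaves (broom b n)" if x: "b - 1 \<le> x" "x < n - 1" for x
  proof
    assume "x \<in> leaves (broom b n)"
    then obtain y where "?N x = {y}" by (auto simp: leaves_def card_1_singleton_iff)
    moreover have "x + 1 \<in> ?N x" "x - 1 \<in> ?N x"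
      using b n x by (auto simp: broom_def parent_tree_def neighbours_def max_def)
    ultimately show False by auto
  qed
  show ?thesis
  proof (intro equalityI subsetI)
    fix x assume x: "x \<in> leaves (broom b n)"
    then have "x < n" by (auto simp: leaves_def pverts_broom)
    then show "x \<in> insert (n - 1) {..<b - 1}" using inner[of x] x by force
  next
    fix x assume "x \<in> insert (n - 1) {..<b - 1}"
    then show "x \<in> leaves (broom b n)"
      using last neighbours_broom_pendant[of x] n by (auto simp: leaves_def pverts_broom)
  qed
qed

lemma broom_in_trees: "broom b n \<in> trees b n"
  using undirected_tree_broom b n by (simp add: trees_def pverts_broom leaves_broom)

end

section \<open>The maximal eigenvalues\<close>

theorem theorem1p3:
  fixes b n :: nat
  assumes "b \<ge> 2" and "n \<ge> b + 1"
  shows "\<forall>k. 3 \<le> k \<and> k \<le> b \<longrightarrow> steklov_max k b n = 1"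
proof (intro allI impI)
  fix k assume k: "3 \<le> k \<and> k \<le> b"
  have nonempty: "leaves T \<noteq> {}" if "T \<in> trees b n" for T
    using that k by (auto simp: trees_def)
  have boundary: "graph_with_boundary T (leaves T)" if "T \<in> trees b n" for T
    using that nonempty[OF that]
    by (auto simp: trees_def undirected_tree_def graph_with_boundary_def
        graph_with_boundary_axioms_def leaves_def)
  have le_1: "\<sigma> \<le> 1" if "T \<in> trees b n" "\<sigma> \<in> set (steklov_eigenvalues T (leaves T))" for T \<sigma>
  proof (rule steklov_eigenvalues_leaves_le_1[of T])
    show "leaves T \<noteq> {}" by (rule nonempty[OF that(1)])
  qed (use that k assms(2) in \<open>auto simp: trees_def undirected_tree_def\<close>)
  have len: "length (steklov_eigenvalues T (leaves T)) = b" if "T \<in> trees b n" for T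
    using graph_with_boundary.length_steklov_eigenvalues[OF boundary[OF that]] that
    by (simp add: trees_def)
  let ?T = "broom b n"
  have b: "3 \<le> b" and T: "?T \<in> trees b n"
    using k assms(2) broom_in_trees[of b n] by auto
  have "card {..<b - 1} - 1 \<le> order 1 (char_poly (steklov_matrix ?T (leaves ?T)))"
    by (rule graph_with_boundary.order_1_char_poly_pendant[OF boundary[OF T], of _ "b - 1"])
      (use b assms(2) neighbours_broom_pendant leaves_broom in \<open>auto simp: lessThan_empty_iff\<close>)
  moreover have "char_poly (steklov_matrix ?T (leaves ?T)) \<noteq> 0"
    using degree_monic_char_poly[OF graph_with_boundary.steklov_matrix_carrier[OF boundary[OF T]]]
    by auto
  ultimately have "b - 2 \<le> count (mset (steklov_eigenvalues ?T (leaves ?T))) 1"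
    by (simp add: steklov_eigenvalues_def)
  then have "steklov_eigenvalues ?T (leaves ?T) ! (k - 1) = 1"
    using k le_1[OF T] len[OF T]
    by (intro sorted_nth_eq_upper_bound[where k = 2]) (auto simp: steklov_eigenvalues_def)
  then have attained: "steklov_eigenvalue k ?T (leaves ?T) = 1"
    by (simp add: steklov_eigenvalue_def)
  show "steklov_max k b n = 1"
    unfolding steklov_max_def
  proof (rule Greatest_equality)
    show "\<exists>T\<in>trees b n. 1 = steklov_eigenvalue k T (leaves T)"
      using T attained by force
  next
    fix s assume "\<exists>T\<in>trees b n. s = steklov_eigenvalue k T (leaves T)"
    then obtain T where "T \<in> trees b n" "s = steklov_eigenvalue k T (leaves T)" by blast
    moreover from this have "s \<in> set (steklov_eigenvalues T (leaves T))"
      using len k by (auto simp: steklov_eigenvalue_def)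
    ultimately show "s \<le> 1" using le_1 by blast
  qed
qed

end
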